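(* Let $K$ be a complete nonarchimedean field of characteristic zero with non-trivial valuation and let $\pi\in K$ with $0<|\pi|<1$. Let $\lambda \in K$ with $\lambda \notin \mathbb{Z}_{\geq 0}$. Then $\mathrm{type}(\lambda)>0$ if and only if there exists some integer $r$ such that $$\frac{\pi^{ir}}{\prod_{j=0}^{i-1}(\lambda-j)}\to 0 \ \text{ as } \ i\to \infty.$$
   Context: For $\lambda\in K$, $\mathrm{type}(\lambda)$ denotes the radius of convergence of the formal power series $\sum_{i\geq 0,\, i\neq \lambda} \frac{x^i}{\lambda-i}$ over $K$. In particular $\mathrm{type}(\lambda)>0$ if and only if there is an integer $r$ with $\pi^{ir}/(\lambda-i)\to0$ as $i\to\infty$. *)

theory Defs
  imports "HOL-Analysis.Analysis" "HOL-Computational_Algebra.Formal_Power_Series"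
begin

text \<open>
  The normed-field classes of the library are real algebras, so their norms are archimedean;
  a nonarchimedean absolute value is therefore carried as an explicit function
  (written multiplicatively, with real values).
\<close>

locale nonarch_absolute_value =
  fixes v :: "'a::field \<Rightarrow> real"
  assumes nonneg: "0 \<le> v x"
    and eq_0_iff: "v x = 0 \<longleftrightarrow> x = 0"
    and mult: "v (x * y) = v x * v y"
    and ultrametric: "v (x + y) \<le> max (v x) (v y)"
begin

lemma v_minus: "v (- x) = v x"
proof -
  have "v 1 * v 1 = v 1" using mult[of 1 1] by simp
  moreover have "v 1 \<noteq> 0" using eq_0_iff[of 1] by simp
  ultimately have one: "v 1 = 1" by simp
  have "(v (- 1))\<^sup>2 = 1" using mult[of "- 1" "- 1"] one by (simp add: power2_eq_square)
  then have "v (- 1) = 1" using nonneg[of "- 1"] by (auto simp: power2_eq_1_iff)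
  then show ?thesis using mult[of "- 1" x] by simp
qed

sublocale metric: Metric_space UNIV "\<lambda>x y. v (x - y)"
proof
  show "v (x - y) = v (y - x)" for x y using v_minus[of "x - y"] by simp
  show "v (x - z) \<le> v (x - y) + v (y - z)" for x y z
    using ultrametric[of "x - y" "y - z"] nonneg[of "x - y"] nonneg[of "y - z"] by simp
qed (simp_all add: nonneg eq_0_iff)

end

locale complete_nonarch_field = nonarch_absolute_value v
  for v :: "'a::field_char_0 \<Rightarrow> real" +
  assumes nontrivial: "\<exists>x. x \<noteq> 0 \<and> v x \<noteq> 1"
    and complete: "metric.mcomplete"

text \<open>
  The Cauchy-Hadamard formula, verbatim the library's \<^const>\<open>conv_radius\<close> with the norm
  replaced by \<open>v\<close>.  It is insensitive to whether the value group is dense, unlike a supremum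
  over the \<open>v x\<close> for those \<open>x\<close> of the field at which the series converges.
\<close>

definition nonarch_conv_radius :: "('a::zero \<Rightarrow> real) \<Rightarrow> 'a fps \<Rightarrow> ereal" where
  "nonarch_conv_radius v f = inverse (limsup (\<lambda>n. ereal (root n (v (fps_nth f n)))))"

lemma (in nonarch_absolute_value) nonarch_conv_radius_eq_conv_radius:
  "nonarch_conv_radius v f = conv_radius (\<lambda>n. v (fps_nth f n))"
  by (simp add: nonarch_conv_radius_def conv_radius_def nonneg)

definition type_fps :: "'a::field_char_0 \<Rightarrow> 'a fps" where
  "type_fps a = Abs_fps (\<lambda>i. if of_nat i = a then 0 else 1 / (a - of_nat i))"

definition nonarch_type :: "('a::field_char_0 \<Rightarrow> real) \<Rightarrow> 'a \<Rightarrow> ereal" where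
  "nonarch_type v a = nonarch_conv_radius v (type_fps a)"

end

theory Submission
  imports Defs
begin

text \<open>
  Write \<open>d\<^sub>i = v (a - i)\<close> and \<open>P\<^sub>i = d\<^sub>0 \<cdots> d\<^sub>i\<^sub>-\<^sub>1\<close>; positivity of the type says that \<open>d\<^sub>i\<close> decays at most
  geometrically.  If \<open>P\<^sub>i\<close> decays at most geometrically, so does \<open>d\<^sub>i = P\<^sub>i\<^sub>+\<^sub>1 / P\<^sub>i\<close>, because \<open>P\<^sub>i\<close>
  grows at most geometrically.  Conversely, let \<open>d\<^sub>k\<close> be the smallest factor of \<open>P\<^sub>i\<close>.  The
  ultrametric inequality gives \<open>d\<^sub>j \<ge> v (j - k)\<close> for all \<open>j \<noteq> k\<close>, so
  \<open>P\<^sub>i \<ge> d\<^sub>k v (k! (i - 1 - k)!)\<close>, and \<open>v (n!)\<close> decays at most geometrically: if \<open>p\<close> is the least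
  positive integer with \<open>v p < 1\<close>, then \<open>v (n!) = v p ^ \<lfloor>n/p\<rfloor> v (\<lfloor>n/p\<rfloor>!)\<close>.
\<close>

text \<open>Terms of a convergent series tend to 0. Conversely, a null sequence is bounded, and
  Abel's lemma turns boundedness at \<open>c\<close> into absolute convergence at
  \<open>c / 2\<close>.\<close>

lemma conv_radius_pos_iff:
  fixes f :: "nat \<Rightarrow> 'a::{banach, real_normed_div_algebra}"
  shows "conv_radius f > 0 \<longleftrightarrow> (\<exists>c>0. (\<lambda>n. norm (f n) * c ^ n) \<longlonglongrightarrow> 0)"
proof
  assume "conv_radius f > 0"
  then obtain c where c: "0 < ereal c" "ereal c < conv_radius f"
    using ereal_dense2 by blast
  then have "summable (\<lambda>n. norm (f n * of_real c ^ n))"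
    by (intro abs_summable_in_conv_radius) simp
  then have "(\<lambda>n. norm (f n) * c ^ n) \<longlonglongrightarrow> 0"
    using c summable_LIMSEQ_zero by (fastforce simp: norm_mult norm_power)
  then show "\<exists>c>0. (\<lambda>n. norm (f n) * c ^ n) \<longlonglongrightarrow> 0"
    using c by auto
next
  assume "\<exists>c>0. (\<lambda>n. norm (f n) * c ^ n) \<longlonglongrightarrow> 0"
  then obtain c where c: "c > 0" "(\<lambda>n. norm (f n) * c ^ n) \<longlonglongrightarrow> 0" by blast
  from c(2) have "Bseq (\<lambda>n. norm (f n) * c ^ n)"
    by (intro convergent_imp_Bseq convergentI)
  then obtain M where M: "\<And>n. norm (norm (f n) * c ^ n) \<le> M"
    using BseqE by blast
  have "summable (\<lambda>n. norm (f n) * (c / 2) ^ n)"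
  proof (rule Abel_lemma)
    show "norm (f n) * c ^ n \<le> M" for n using M[of n] by simp
  qed (use c in auto)
  then have "summable (\<lambda>n. norm (f n * of_real (c / 2) ^ n))"
    using c by (simp add: norm_mult norm_power del: of_real_divide)
  then have "conv_radius f \<ge> norm (of_real (c / 2) :: 'a)"
    by (rule conv_radius_geI[OF summable_norm_cancel])
  then show "conv_radius f > 0"
    using c by (auto intro: less_le_trans[of 0 "ereal (c / 2)"] simp del: of_real_divide)
qed

section \<open>Elementary properties of a nonarchimedean absolute value\<close>

context nonarch_absolute_value
begin

lemma v_zero [simp]: "v 0 = 0"
  using eq_0_iff by simp

lemma v_pos: "x \<noteq> 0 \<Longrightarrow> 0 < v x"
  using nonneg[of x] eq_0_iff[of x] by simp

lemma v_one [simp]: "v 1 = 1"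
proof -
  have "v 1 * v 1 = v 1" using mult[of 1 1] by simp
  then show ?thesis using eq_0_iff[of 1] by simp
qed

lemma v_power: "v (x ^ n) = v x ^ n"
  by (induction n) (simp_all add: mult)

lemma v_prod: "v (prod f A) = (\<Prod>x\<in>A. v (f x))"
  by (induction A rule: infinite_finite_induct) (simp_all add: mult)

lemma v_divide: "v (x / y) = v x / v y"
proof (cases "y = 0")
  case False
  then show ?thesis using mult[of "x / y" y] eq_0_iff[of y] by (simp add: field_simps)
qed simp

lemma v_diff_le: "v (x - y) \<le> max (v x) (v y)"
  using ultrametric[of x "- y"] by (simp add: v_minus)

lemma v_of_nat_le_1: "v (of_nat n) \<le> 1"
proof (induction n)
  case (Suc n)
  then show ?case using ultrametric[of 1 "of_nat n"] by simp
qed simp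

text \<open>Writing \<open>y\<close> as \<open>(x + y) - x\<close> gives
  \<open>1 \<le> max (v (x + y)) (v x)\<close>, and the maximum cannot be
  \<open>v x\<close>.\<close>

lemma v_add_eq_1: "v x < 1 \<Longrightarrow> v y = 1 \<Longrightarrow> v (x + y) = 1"
  using ultrametric[of x y] v_diff_le[of "x + y" x] by simp

end

section \<open>Geometric lower bounds for factorials and shifted products\<close>

locale nonarch_absolute_value_char_0 = nonarch_absolute_value v
  for v :: "'a::field_char_0 \<Rightarrow> real"
begin

lemma v_fact_ge_power: "\<exists>\<theta>>0. \<theta> \<le> 1 \<and> (\<forall>n. \<theta> ^ n \<le> v (fact n))"
proof (cases "\<exists>p>0. v (of_nat p) < 1")
  case False
  then have "v (of_nat n) = 1" if "n > 0" for n
    using that v_of_nat_le_1[of n] by (meson not_less order_antisym)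
  then have "v (fact n) = 1" for n
    unfolding fact_prod of_nat_prod v_prod by (intro prod.neutral) auto
  then show ?thesis by (intro exI[of _ 1]) simp
next
  case True
  define p where "p = (LEAST p. p > 0 \<and> v (of_nat p) < 1)"
  have p: "p > 0" "v (of_nat p) < 1"
    using LeastI_ex[OF True] unfolding p_def by auto
  have least: "v (of_nat r) = 1" if "0 < r" "r < p" for r
    using not_less_Least[of r "\<lambda>p. p > 0 \<and> v (of_nat p) < 1"] v_of_nat_le_1[of r] that
    unfolding p_def by fastforce
  have "p \<ge> 2" using p by (cases "p = 1") auto
  \<comment> \<open>Division with remainder: the multiple of \<open>p\<close> has value below 1,
    while the nonzero remainder has value 1 by minimality of \<open>p\<close>.\<close>
  have unit: "v (of_nat n) = 1" if "\<not> p dvd n" for n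
  proof -
    have "v (of_nat (p * (n div p)) + of_nat (n mod p)) = 1"
    proof (rule v_add_eq_1)
      have "v (of_nat (p * (n div p))) \<le> v (of_nat p)"
        using v_of_nat_le_1[of "n div p"] nonneg[of "of_nat p"]
        by (simp add: mult mult_left_le)
      then show "v (of_nat (p * (n div p))) < 1" using p by simp
      show "v (of_nat (n mod p)) = 1"
        using that p by (intro least) (auto simp: dvd_eq_mod_eq_0)
    qed
    then show ?thesis by (simp only: of_nat_add [symmetric] mult_div_mod_eq)
  qed
  \<comment> \<open>Only multiples of \<open>p\<close> change the value. The factor
    \<open>p * Suc (n div p)\<close> contributes one \<open>v p\<close> and the next factor of the
    smaller factorial.\<close>
  have step: "v (fact n) = v (of_nat p) ^ (n div p) * v (fact (n div p))" for n
  proof (induction n)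
    case (Suc n)
    have fact_Suc: "v (fact (Suc m)) = v (of_nat (Suc m)) * v (fact m)" for m
      by (simp only: fact_Suc mult)
    show ?case
    proof (cases "p dvd Suc n")
      case True
      then have div: "Suc n div p = Suc (n div p)" by (simp add: div_Suc dvd_eq_mod_eq_0)
      then have "Suc n = p * Suc (n div p)" using True by (metis dvd_mult_div_cancel)
      then have "v (of_nat (Suc n)) = v (of_nat p) * v (of_nat (Suc (n div p)))"
        by (metis of_nat_mult mult)
      then show ?thesis unfolding div fact_Suc Suc.IH by simp
    next
      case False
      then have "Suc n div p = n div p" by (simp add: div_Suc dvd_eq_mod_eq_0)
      then show ?thesis using unit[OF False] unfolding fact_Suc Suc.IH by simp
    qed
  qed simp
  \<comment> \<open>With \<open>m = n div p\<close>, \<open>step\<close> and induction bound the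
    right-hand side below by \<open>v p ^ (2 * m)\<close>. Since \<open>p \<ge> 2\<close>,
    \<open>2 * m \<le> n\<close>, and the base is below 1.\<close>
  have "v (of_nat p) ^ n \<le> v (fact n)" for n
  proof (induction n rule: less_induct)
    case (less n)
    show ?case
    proof (cases "n = 0")
      case False
      have "2 * (n div p) \<le> p * (n div p)" using \<open>p \<ge> 2\<close> by simp
      also have "\<dots> \<le> n" by simp
      finally have "n div p + n div p \<le> n" by simp
      then have "v (of_nat p) ^ n \<le> v (of_nat p) ^ (n div p + n div p)"
        using nonneg p by (intro power_decreasing) auto
      also have "\<dots> \<le> v (of_nat p) ^ (n div p) * v (fact (n div p))"
        unfolding power_add using False \<open>p \<ge> 2\<close> nonneg
        by (intro mult_left_mono less.IH) auto
      finally show ?thesis using step[of n] by simp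
    qed simp
  qed
  moreover have "v (of_nat p) > 0" using p v_pos by simp
  ultimately show ?thesis using p by (intro exI[of _ "v (of_nat p)"]) auto
qed

text \<open>Besides \<open>k\<close> itself, the indices below \<open>k\<close> lie at distances
  \<open>1, ..., k\<close> from it and those above at distances \<open>1, ..., i - 1 - k\<close>;
  this produces the two factorials.\<close>

lemma v_prod_diff_ge_fact:
  assumes "k < i" and min: "\<And>j. j < i \<Longrightarrow> v (a - of_nat k) \<le> v (a - of_nat j)"
  shows "v (a - of_nat k) * (v (fact k) * v (fact (i - 1 - k))) \<le> (\<Prod>j<i. v (a - of_nat j))"
proof -
  \<comment> \<open>\<open>j - k\<close> is the difference of \<open>a - k\<close> and
    \<open>a - j\<close>, and the second has the larger value by minimality.\<close>
  have dist: "v (of_nat j - of_nat k) \<le> v (a - of_nat j)" if "j < i" for j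
    using v_diff_le[of "a - of_nat k" "a - of_nat j"] min[OF that] by simp
  have "(\<Prod>j<k. v (of_nat j - of_nat k)) = (\<Prod>j<k. v (of_nat (k - j)))"
    by (intro prod.cong) (auto simp: metric.commute[of _ "of_nat k"])
  also have "\<dots> = v (fact k)"
    unfolding fact_prod_rev v_prod of_nat_prod by (simp add: atLeast0LessThan)
  finally have left: "v (fact k) = (\<Prod>j<k. v (of_nat j - of_nat k))" by simp
  have right: "v (fact (i - 1 - k)) = (\<Prod>j\<in>{Suc k..<i}. v (of_nat j - of_nat k))"
    unfolding fact_prod v_prod of_nat_prod
    by (rule prod.reindex_bij_witness[of _ "\<lambda>j. j - k" "\<lambda>j. j + k"])
      (use assms(1) in \<open>auto simp: of_nat_diff\<close>)
  have split: "{..<i} = insert k ({..<k} \<union> {Suc k..<i})" using assms(1) by auto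
  have "(\<Prod>j<i. v (a - of_nat j)) = v (a - of_nat k) *
      ((\<Prod>j<k. v (a - of_nat j)) * (\<Prod>j\<in>{Suc k..<i}. v (a - of_nat j)))"
    unfolding split by (subst prod.insert; (subst prod.union_disjoint)?) auto
  moreover have "v (fact k) \<le> (\<Prod>j<k. v (a - of_nat j))"
    unfolding left using assms(1) by (intro prod_mono conjI nonneg dist) auto
  moreover have "v (fact (i - 1 - k)) \<le> (\<Prod>j\<in>{Suc k..<i}. v (a - of_nat j))"
    unfolding right by (intro prod_mono conjI nonneg dist) auto
  ultimately show ?thesis
    by (auto intro!: mult_left_mono mult_mono nonneg prod_nonneg)
qed

text \<open>Multiplying the bounds \<open>lower\<close> would give an exponent quadratic in
  \<open>i\<close>. So \<open>lower\<close> is applied to the smallest factor alone, and the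
  factorials control the others.\<close>

lemma v_prod_diff_ge_power:
  assumes "0 < c" "0 < C" and lower: "\<And>i. C * c ^ i \<le> v (a - of_nat i)"
  shows "\<exists>D>0. \<exists>q>0. \<forall>i. D * q ^ i \<le> (\<Prod>j<i. v (a - of_nat j))"
proof -
  obtain \<theta> where \<theta>: "0 < \<theta>" "\<theta> \<le> 1" "\<And>n. \<theta> ^ n \<le> v (fact n)"
    using v_fact_ge_power by blast
  \<comment> \<open>The minimising index \<open>k\<close> is only known to be below
    \<open>i\<close>; a base at most 1 makes \<open>b ^ i \<le> b ^ k\<close> for every such
    \<open>k\<close>.\<close>
  define b where "b = min c 1"
  have b: "0 < b" "b \<le> 1" "b \<le> c" using assms(1) by (auto simp: b_def)
  have "C * (b * \<theta>) ^ i \<le> (\<Prod>j<i. v (a - of_nat j))" if i: "i > 0" for i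
  proof -
    obtain k where k: "k < i" "\<And>j. j < i \<Longrightarrow> v (a - of_nat k) \<le> v (a - of_nat j)"
      using ex_is_arg_min_if_finite[of "{..<i}" "\<lambda>j. v (a - of_nat j)"] i
      by (auto simp: is_arg_min_linorder lessThan_empty_iff)
    have "b ^ i \<le> b ^ k" using b k by (intro power_decreasing) auto
    also have "\<dots> \<le> c ^ k" using b by (intro power_mono) auto
    finally have "C * b ^ i \<le> v (a - of_nat k)"
      using lower[of k] assms(2) by (smt (verit) mult_left_mono)
    moreover have "\<theta> ^ i \<le> v (fact k) * v (fact (i - 1 - k))"
    proof -
      \<comment> \<open>The exponent on the right is \<open>i - 1\<close>;
        \<open>\<theta> \<le> 1\<close> absorbs the missing factor.\<close>
      have "\<theta> ^ i \<le> \<theta> ^ (k + (i - 1 - k))" using \<theta> k by (intro power_decreasing) auto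
      also have "\<dots> \<le> v (fact k) * v (fact (i - 1 - k))"
        unfolding power_add using \<theta> nonneg by (intro mult_mono) auto
      finally show ?thesis .
    qed
    ultimately have "(C * b ^ i) * \<theta> ^ i \<le>
        v (a - of_nat k) * (v (fact k) * v (fact (i - 1 - k)))"
      using \<theta> nonneg by (intro mult_mono) auto
    then show ?thesis
      using v_prod_diff_ge_fact[OF k] by (simp add: power_mult_distrib mult.assoc)
  qed
  \<comment> \<open>The minimum with 1 covers the empty product at \<open>i = 0\<close>.\<close>
  moreover have "min C 1 * (b * \<theta>) ^ i \<le> C * (b * \<theta>) ^ i" for i
    using b \<theta> by (intro mult_right_mono) auto
  ultimately have "min C 1 * (b * \<theta>) ^ i \<le> (\<Prod>j<i. v (a - of_nat j))" for i
    by (cases "i = 0") (auto intro: order_trans)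
  then show ?thesis
    using assms(2) b \<theta> by (intro exI[of _ "min C 1"] exI[of _ "b * \<theta>"] conjI allI) auto
qed

lemma nonarch_type_pos_iff:
  assumes "a \<notin> \<nat>"
  shows "nonarch_type v a > 0 \<longleftrightarrow> (\<exists>c>0. (\<lambda>n. c ^ n / v (a - of_nat n)) \<longlonglongrightarrow> 0)"
proof -
  have "of_nat n \<noteq> a" for n using assms by auto
  then have "v (fps_nth (type_fps a) n) = 1 / v (a - of_nat n)" for n
    by (simp add: type_fps_def v_divide)
  then show ?thesis
    by (simp add: nonarch_type_def nonarch_conv_radius_eq_conv_radius conv_radius_pos_iff nonneg)
qed

end

theorem lemmaB2:
  fixes v :: "'a::field_char_0 \<Rightarrow> real" and \<pi> a :: 'a
  assumes "complete_nonarch_field v"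
    and "0 < v \<pi>" and "v \<pi> < 1"
    and "a \<notin> \<nat>"
  shows "nonarch_type v a > 0 \<longleftrightarrow>
    (\<exists>r::int. (\<lambda>i::nat. v ((\<pi> powi (int i * r)) / (\<Prod>j<i. a - of_nat j))) \<longlonglongrightarrow> 0)"
proof -
  interpret complete_nonarch_field v by fact
  interpret nonarch_absolute_value_char_0 v ..
  define P where "P i = (\<Prod>j<i. v (a - of_nat j))" for i
  have d_pos: "v (a - of_nat i) > 0" for i
    using assms(4) by (intro v_pos) auto
  have P_pos: "P i > 0" for i
    unfolding P_def by (intro prod_pos) (simp add: d_pos)
  have term_eq: "v (\<pi> powi (int i * r) / (\<Prod>j<i. a - of_nat j)) = v (\<pi> powi r) ^ i / P i" for i r
  proof -
    have "\<pi> powi (int i * r) = (\<pi> powi r) ^ i"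
      by (metis mult.commute power_int_mult power_int_of_nat)
    then show ?thesis by (simp add: v_divide v_power v_prod P_def)
  qed
  show ?thesis
    unfolding nonarch_type_pos_iff[OF assms(4)] term_eq
  proof
    assume "\<exists>c>0. (\<lambda>n. c ^ n / v (a - of_nat n)) \<longlonglongrightarrow> 0"
    then obtain c where c: "c > 0" "(\<lambda>n. c ^ n / v (a - of_nat n)) \<longlonglongrightarrow> 0" by blast
    from c(2) have "Bseq (\<lambda>n. c ^ n / v (a - of_nat n))"
      by (intro convergent_imp_Bseq convergentI)
    then obtain M where M: "M > 0" "\<And>n. norm (c ^ n / v (a - of_nat n)) \<le> M"
      using BseqE by blast
    have "1 / M * c ^ n \<le> v (a - of_nat n)" for n
      using M(1) M(2)[of n] c(1) d_pos[of n] by (simp add: field_simps)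
    then obtain D q where D: "D > 0" and q: "q > 0" and lower: "\<And>i. D * q ^ i \<le> P i"
      using v_prod_diff_ge_power[of c "1 / M" a] c(1) M(1) unfolding P_def by auto
    \<comment> \<open>Powers of \<open>v \<pi>\<close> become arbitrarily small, so some
      \<open>r\<close> makes the ratio \<open>v \<pi> ^ r / q\<close> less than 1.\<close>
    obtain r where r: "v \<pi> ^ r < q" using real_arch_pow_inv[OF q assms(3)] by blast
    have bound: "v (\<pi> powi int r) ^ i / P i \<le> 1 / D * (v \<pi> ^ r / q) ^ i" for i
    proof -
      have "(v \<pi> ^ r) ^ i / P i \<le> (v \<pi> ^ r) ^ i / (D * q ^ i)"
        using lower[of i] D q assms(2) by (intro divide_left_mono) (auto simp: P_pos)
      then show ?thesis by (simp add: v_power power_divide)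
    qed
    have lim: "(\<lambda>i. 1 / D * (v \<pi> ^ r / q) ^ i) \<longlonglongrightarrow> 1 / D * 0"
      using r q assms(2) by (intro tendsto_mult_left LIMSEQ_realpow_zero) auto
    have "(\<lambda>i. v (\<pi> powi int r) ^ i / P i) \<longlonglongrightarrow> 0"
      by (rule Lim_null_comparison[OF always_eventually lim[simplified mult_zero_right]])
        (use bound P_pos in \<open>simp add: nonneg less_imp_le\<close>)
    then show "\<exists>r. (\<lambda>i. v (\<pi> powi r) ^ i / P i) \<longlonglongrightarrow> 0" ..
  next
    assume "\<exists>r. (\<lambda>i. v (\<pi> powi r) ^ i / P i) \<longlonglongrightarrow> 0"
    then obtain r where r: "(\<lambda>i. v (\<pi> powi r) ^ i / P i) \<longlonglongrightarrow> 0" by blast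
    define q where "q = v (\<pi> powi r)"
    have q: "q > 0" unfolding q_def using assms(2) by (intro v_pos) auto
    \<comment> \<open>Integers have value at most 1, so the ultrametric inequality bounds every
      factor by \<open>M\<close>, uniformly in the index.\<close>
    define M where "M = max (v a) 1"
    have M: "M > 0" by (simp add: M_def)
    have d_le: "v (a - of_nat j) \<le> M" for j
      using v_diff_le[of a "of_nat j"] v_of_nat_le_1[of j] by (simp add: M_def)
    have "P i \<le> M ^ i" for i
      using prod_mono[of "{..<i}" "\<lambda>j. v (a - of_nat j)" "\<lambda>_. M"] d_le nonneg
      by (simp add: P_def)
    \<comment> \<open>The factor at \<open>i\<close> is \<open>P (Suc i) / P i\<close>. Dividing
      \<open>q\<close> by \<open>M\<close> absorbs \<open>P i \<le> M ^ i\<close>, and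
      \<open>1 / q\<close> compensates for the index shift.\<close>
    have bound: "(q / M) ^ i / v (a - of_nat i) \<le> 1 / q * (q ^ Suc i / P (Suc i))" for i
    proof -
      have "(q / M) ^ i / v (a - of_nat i) = (q ^ i / P (Suc i)) * (P i / M ^ i)"
      proof -
        have "P (Suc i) = P i * v (a - of_nat i)" by (simp add: P_def)
        then show ?thesis using P_pos[of i] by (simp add: power_divide)
      qed
      also have "\<dots> \<le> (q ^ i / P (Suc i)) * 1"
        using \<open>P i \<le> M ^ i\<close> q M P_pos[of "Suc i"] by (intro mult_left_mono) auto
      finally show ?thesis using q by simp
    qed
    have lim: "(\<lambda>i. 1 / q * (q ^ Suc i / P (Suc i))) \<longlonglongrightarrow> 1 / q * 0"
      using LIMSEQ_Suc[OF r] unfolding q_def by (intro tendsto_mult_left)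
    have "(\<lambda>i. (q / M) ^ i / v (a - of_nat i)) \<longlonglongrightarrow> 0"
      by (rule Lim_null_comparison[OF always_eventually lim[simplified mult_zero_right]])
        (use bound q M in \<open>simp add: nonneg\<close>)
    then show "\<exists>c>0. (\<lambda>n. c ^ n / v (a - of_nat n)) \<longlonglongrightarrow> 0"
      using q M by (intro exI[of _ "q / M"]) simp
  qed
qed

end
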